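(* Let $F$ be a field with $\operatorname{char}(F)\neq 2$ and let $L$ be a $6$-dimensional pure nilpotent Lie algebra over $F$ with $b(L)=2$ and $\dim Z(L)=2=\dim[L,L]$, where $Z(L)$ is the center of $L$. Then $L$ has a basis $\{x_1,x_2,x_3,x_4,z_1,z_2\}$ such that one of the following holds: (1) $[x_1,x_2]=z_1$, $[x_3,x_4]=z_2$; or (2) $[x_1,x_2]=z_1$, $[x_2,x_3]=z_2$, $[x_3,x_4]=z_1$, $[x_1,x_4]=\alpha z_2$ for some $\alpha\in F$. In each case all brackets of basis vectors not listed (apart from those determined by antisymmetry) are zero.
   Context: For a finite dimensional Lie algebra $L$ and $x\in L$, $\operatorname{ad}_x:L\to L$ denotes the map $y\mapsto [x,y]$. The breadth of $L$ is $b(L)=\max\{\operatorname{rank}(\operatorname{ad}_x)\mid x\in L\}$. A Lie algebra is called pure if it does not have a (nonzero) abelian ideal as a direct summand; equivalently, $Z(L)\subseteq [L,L]$. *)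

theory Defs
  imports "HOL-Computational_Algebra.Computational_Algebra"
begin

text \<open>
  A Lie algebra over the field \<open>'f\<close> whose underlying vector space is the whole type \<open>'v\<close>.
  The bracket is alternating in the strong sense \<open>[x,x] = 0\<close>, which is the correct
  axiom in every characteristic.
\<close>

locale lie_algebra = vector_space scale
  for scale :: "'f::field \<Rightarrow> 'v::ab_group_add \<Rightarrow> 'v" +
  fixes bracket :: "'v \<Rightarrow> 'v \<Rightarrow> 'v"
  assumes bracket_add_left: "bracket (x + y) z = bracket x z + bracket y z"
    and bracket_add_right: "bracket x (y + z) = bracket x y + bracket x z"
    and bracket_scale_left: "bracket (scale c x) y = scale c (bracket x y)"
    and bracket_scale_right: "bracket x (scale c y) = scale c (bracket x y)"
    and bracket_self: "bracket x x = 0"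
    and jacobi: "bracket x (bracket y z) + bracket y (bracket z x) + bracket z (bracket x y) = 0"
begin

definition ad :: "'v \<Rightarrow> 'v \<Rightarrow> 'v" where
  "ad x = (\<lambda>y. bracket x y)"

definition center :: "'v set" where
  "center = {z. \<forall>y. bracket z y = 0}"

definition bracket_space :: "'v set \<Rightarrow> 'v set \<Rightarrow> 'v set" where
  "bracket_space A B = span {bracket a b | a b. a \<in> A \<and> b \<in> B}"

definition derived_algebra :: "'v set" where
  "derived_algebra = bracket_space UNIV UNIV"

primrec lower_central :: "nat \<Rightarrow> 'v set" where
  "lower_central 0 = UNIV"
| "lower_central (Suc n) = bracket_space UNIV (lower_central n)"

definition nilpotent :: bool where
  "nilpotent \<longleftrightarrow> (\<exists>n. lower_central n = {0})"

text \<open>In finite dimension the set of ranks is finite and nonempty, so \<open>Max\<close> is meaningful.\<close>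

definition breadth :: nat where
  "breadth = Max {dim (range (ad x)) | x. True}"

definition lie_ideal :: "'v set \<Rightarrow> bool" where
  "lie_ideal I \<longleftrightarrow> subspace I \<and> (\<forall>x. \<forall>y\<in>I. bracket x y \<in> I)"

definition abelian :: "'v set \<Rightarrow> bool" where
  "abelian A \<longleftrightarrow> (\<forall>x\<in>A. \<forall>y\<in>A. bracket x y = 0)"

text \<open>
  A direct summand is a summand in the sense of Lie algebras: the complement is an ideal too,
  not merely a complementary subspace.
\<close>

definition direct_summand :: "'v set \<Rightarrow> bool" where
  "direct_summand A \<longleftrightarrow> lie_ideal A \<and>
     (\<exists>B. lie_ideal B \<and> A \<inter> B = {0} \<and> {a + b | a b. a \<in> A \<and> b \<in> B} = UNIV)"

definition pure :: bool where
  "pure \<longleftrightarrow> \<not> (\<exists>A. A \<noteq> {0} \<and> abelian A \<and> direct_summand A)"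

definition is_basis :: "'v list \<Rightarrow> bool" where
  "is_basis vs \<longleftrightarrow> distinct vs \<and> independent (set vs) \<and> span (set vs) = UNIV"

end

end

theory Submission
  imports Defs
begin

text \<open>
  Purity gives \<open>center \<subseteq> derived_algebra\<close>, and both spaces have dimension two, so they coincide.
  After a basis \<open>z1\<close>, \<open>z2\<close> of the centre is chosen, the bracket is therefore a pair
  of alternating bilinear forms, \<open>[x, y] = f x y z1 + g x y z2\<close>, on the four-dimensional quotient by
  the centre. Their common radical is zero there, and they are linearly independent because the
  derived algebra is not a line. A change of basis of the centre replaces \<open>f\<close>, \<open>g\<close> by another basis
  of the pencil that they span.

  Some form of the pencil is nondegenerate on the quotient: if the Pfaffian vanished on the whole
  pencil, then every form would have rank at most two, and the two forms would have a
  common radical vector (\<open>symplectic_coordinates_exist\<close>). Let \<open>f\<close> be nondegenerate. The Pfaffian is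
  a quadratic form on the pencil, and since \<open>2\<close> is invertible a multiple of \<open>f\<close>
  can be added to \<open>g\<close> so that \<open>g\<close> becomes orthogonal to \<open>f\<close> for its polarisation
  (\<open>trace_free_coordinates_exist\<close>). Let \<open>A\<close> be the operator with \<open>f (A u) w = g u w\<close>. Its Pfaffian
  characteristic polynomial now has no linear term, so Cayley--Hamilton makes \<open>A\<^sup>2\<close> a scalar \<open>\<beta>\<close>
  modulo the centre (\<open>adjoint_operator_exists\<close>).

  As \<open>A\<close> is not a scalar, there are \<open>u\<close>, \<open>w\<close> with \<open>f u w = 0\<close> and \<open>g u w = 1\<close>
  (\<open>orthogonal_pair_exists\<close>), and \<open>- A w, u, w, - A u\<close> is the required basis modulo the centre, with
  \<open>\<alpha> = - \<beta>\<close> (\<open>normal_form_of_adjoint_operator\<close>). So the second alternative always holds;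
  the algebra of the first one appears in it as \<open>\<alpha> = - 1\<close>, because the product \<open>s t\<close> and
  the difference of squares \<open>s\<^sup>2 - t\<^sup>2\<close> are equivalent quadratic forms when \<open>2\<close> is invertible.
\<close>

section \<open>Alternating forms\<close>

locale alternating_form = vector_space scale
  for scale :: "'f::field \<Rightarrow> 'v::ab_group_add \<Rightarrow> 'v" +
  fixes f :: "'v \<Rightarrow> 'v \<Rightarrow> 'f"
  assumes add_left: "f (x + y) z = f x z + f y z"
    and add_right: "f x (y + z) = f x y + f x z"
    and scale_left: "f (scale c x) y = c * f x y"
    and self: "f x x = 0"
begin

lemma antisym: "f y x = - f x y"
proof -
  have "f (x + y) (x + y) = f x y + f y x"
    unfolding add_left add_right by (simp add: self)
  then have "f x y + f y x = 0" by (simp add: self)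
  then show ?thesis by (metis add.commute eq_neg_iff_add_eq_0)
qed

lemma scale_right: "f x (scale c y) = c * f x y"
  using antisym[of "scale c y" x] antisym[of y x] by (simp add: scale_left)

lemma zero_left: "f 0 y = 0"
  using scale_left[of 0 0 y] by simp

lemma minus_left: "f (- x) y = - f x y"
  using add_left[of x "- x" y] by (simp add: zero_left minus_unique)

lemma diff_left: "f (x - y) z = f x z - f y z"
  using add_left[of x "- y" z] by (simp add: minus_left)

lemma zero_right: "f x 0 = 0"
  using scale_right[of x 0 0] by simp

lemma minus_right: "f x (- y) = - f x y"
  using add_right[of x y "- y"] by (simp add: zero_right minus_unique)

lemma diff_right: "f x (y - z) = f x y - f x z"
  using add_right[of x y "- z"] by (simp add: minus_right)

lemmas expand = add_left add_right diff_left diff_right minus_left minus_right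
  scale_left scale_right zero_left zero_right self

lemma vanishes_on_span:
  assumes "w \<in> span S" "\<And>s. s \<in> S \<Longrightarrow> f x s = 0"
  shows "f x w = 0"
  using assms(1)
  by (induction rule: span_induct_alt) (simp_all add: expand assms(2))

lemma not_in_span:
  assumes "f x w \<noteq> 0" "\<And>s. s \<in> S \<Longrightarrow> f x s = 0"
  shows "w \<notin> span S"
  using vanishes_on_span assms by blast

definition symplectic :: "'v \<Rightarrow> 'v \<Rightarrow> 'v \<Rightarrow> 'v \<Rightarrow> bool" where
  "symplectic a b c d \<longleftrightarrow> f a b = 1 \<and> f c d = 1 \<and> f a c = 0 \<and> f a d = 0 \<and> f b c = 0 \<and> f b d = 0"

text \<open>One Gram--Schmidt step: subtracting from \<open>c\<close> and \<open>d\<close> their components along the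
  hyperbolic pair built from \<open>a\<close> and \<open>b\<close> divides the Pfaffian by \<open>f a b\<close>.\<close>

lemma symplectic_from_pair:
  assumes "f a b \<noteq> 0" "f a b * f c d - f a c * f b d + f a d * f b c \<noteq> 0"
  shows "\<exists>x y z w. symplectic x y z w"
proof -
  define v where "v = scale (1 / f a b) b"
  have av: "f a v = 1" using assms(1) by (simp add: v_def expand)
  have va: "f v a = - 1" using av antisym[of v a] by simp
  define p where "p = c - scale (f c v) a + scale (f c a) v"
  define q where "q = d - scale (f d v) a + scale (f d a) v"
  have *: "f a p = 0" "f v p = 0" "f a q = 0" "f v q = 0"
    using antisym[of a c] antisym[of a d] antisym[of v c] antisym[of v d]
    by (simp_all add: p_def q_def expand av va)
  have "f p q = f c q" using * by (simp add: p_def expand)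
  also have "\<dots> = f c d + f a c * f d v - f a d * f c v"
    using antisym[of d a] antisym[of c a]
    by (simp add: q_def expand algebra_simps)
  also have "\<dots> = (f a b * f c d - f a c * f b d + f a d * f b c) / f a b"
    using assms(1) antisym[of b c] antisym[of d b] by (simp add: v_def expand field_simps)
  finally have "f p q \<noteq> 0" using assms by simp
  then have "symplectic a v p (scale (1 / f p q) q)"
    using * av by (simp add: symplectic_def expand)
  then show ?thesis by blast
qed

text \<open>If the Pfaffian is nonzero, then \<open>a\<close> is not orthogonal to all of \<open>b\<close>, \<open>c\<close>, \<open>d\<close>, and
  a cyclic permutation of these three does not change the Pfaffian.\<close>

lemma symplectic_from_Pfaffian:
  assumes "f a b * f c d - f a c * f b d + f a d * f b c \<noteq> 0"
  shows "\<exists>x y z w. symplectic x y z w"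
proof -
  consider "f a b \<noteq> 0" | "f a c \<noteq> 0" | "f a d \<noteq> 0" using assms by fastforce
  then show ?thesis
  proof cases
    case 1
    then show ?thesis using assms by (rule symplectic_from_pair)
  next
    case 2
    have "f a c * f d b - f a d * f c b + f a b * f c d \<noteq> 0"
      using assms antisym[of d b] antisym[of c b] by (simp add: algebra_simps)
    with 2 show ?thesis by (rule symplectic_from_pair)
  next
    case 3
    have "f a d * f b c - f a b * f d c + f a c * f d b \<noteq> 0"
      using assms antisym[of d b] antisym[of d c] by (simp add: algebra_simps)
    with 3 show ?thesis by (rule symplectic_from_pair)
  qed
qed

end

section \<open>Centre, derived algebra and coordinates\<close>

context lie_algebra
begin

lemma bracket_zero: "bracket 0 x = 0" "bracket x 0 = 0"
  using bracket_add_left[of 0 0 x] bracket_add_right[of x 0 0] by simp_all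

lemma bracket_antisym: "bracket y x = - bracket x y"
proof -
  have "bracket (x + y) (x + y) = bracket x y + bracket y x"
    unfolding bracket_add_left bracket_add_right by (simp add: bracket_self)
  then have "bracket x y + bracket y x = 0" by (simp add: bracket_self)
  then show ?thesis by (metis add.commute eq_neg_iff_add_eq_0)
qed

lemma center_iff: "z \<in> center \<longleftrightarrow> (\<forall>y. bracket z y = 0)"
  by (simp add: center_def)

lemma subspace_center: "subspace center"
  by (rule subspaceI) (simp_all add: center_iff bracket_zero bracket_add_left bracket_scale_left)

lemma bracket_in_derived: "bracket x y \<in> derived_algebra"
  unfolding derived_algebra_def bracket_space_def by (rule span_base) blast

lemma subspace_derived: "subspace derived_algebra"
  unfolding derived_algebra_def bracket_space_def by (rule subspace_span)

text \<open>A central element \<open>z\<close> outside the derived algebra would span an abelian ideal; any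
  hyperplane that contains the derived algebra and misses \<open>z\<close> is a complementary ideal.\<close>

lemma pure_center_subset_derived:
  assumes "pure"
  shows "center \<subseteq> derived_algebra"
proof (rule ccontr)
  assume "\<not> center \<subseteq> derived_algebra"
  then obtain z where z: "z \<in> center" "z \<notin> derived_algebra" by blast
  obtain D where D: "D \<subseteq> derived_algebra" "independent D" "derived_algebra \<subseteq> span D"
    using maximal_independent_subset by metis
  have sD: "span D = derived_algebra"
    using D subspace_derived span_minimal by blast
  have iz: "independent (insert z D)"
    using D(2) z(2) sD by (simp add: independent_insert)
  obtain C where C: "insert z D \<subseteq> C" "independent C" "UNIV \<subseteq> span C"
    using maximal_independent_subset_extend[OF subset_UNIV iz] by metis
  let ?A = "span {z}" and ?B = "span (C - {z})"
  have zD: "z \<notin> D" using z(2) D(1) by blast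
  have zB: "z \<notin> ?B" using C(1,2) by (auto simp: dependent_def)
  have DB: "derived_algebra \<subseteq> ?B"
    unfolding sD[symmetric] using C(1) zD by (intro span_mono) blast
  have Ac: "?A \<subseteq> center"
    using z(1) subspace_center by (intro span_minimal) auto
  have cen: "bracket x a = 0" "bracket a x = 0" if "a \<in> ?A" for a x
    using Ac that bracket_antisym[of x a] by (auto simp: center_iff)
  have "lie_ideal ?A" by (simp add: lie_ideal_def cen subspace_span span_zero)
  moreover have "lie_ideal ?B"
    using DB bracket_in_derived by (auto simp: lie_ideal_def subspace_span)
  moreover have "?A \<inter> ?B = {0}"
  proof -
    have "a = 0" if a: "a \<in> ?A" "a \<in> ?B" for a
    proof -
      obtain k where k: "a = scale k z" using a(1) by (auto simp: span_singleton)
      have "k = 0"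
      proof (rule ccontr)
        assume "k \<noteq> 0"
        then have "z = scale (1 / k) a" using k by simp
        then show False using zB span_scale[OF a(2)] by metis
      qed
      then show ?thesis using k by simp
    qed
    then show ?thesis using span_zero by blast
  qed
  moreover have "{a + b | a b. a \<in> ?A \<and> b \<in> ?B} = UNIV"
  proof -
    have "insert z (C - {z}) = C" using C(1) by blast
    then have "span ({z} \<union> (C - {z})) = UNIV" using C(3) by auto
    then show ?thesis by (simp only: span_Un)
  qed
  ultimately have "direct_summand ?A" unfolding direct_summand_def by blast
  moreover have "abelian ?A" by (simp add: abelian_def cen)
  moreover have "?A \<noteq> {0}"
    using span_base[of z "{z}"] z(2) subspace_0[OF subspace_derived] by auto
  ultimately show False using assms unfolding pure_def by blast
qed

text \<open>Uniqueness of coordinates makes \<open>f\<close> and \<open>g\<close> bilinear and alternating, so a change of basis of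
  the centre only has to transform the formula for the bracket.\<close>

definition coordinates :: "'v \<Rightarrow> 'v \<Rightarrow> ('v \<Rightarrow> 'v \<Rightarrow> 'f) \<Rightarrow> ('v \<Rightarrow> 'v \<Rightarrow> 'f) \<Rightarrow> bool" where
  "coordinates z1 z2 f g \<longleftrightarrow> z1 \<noteq> z2 \<and> independent {z1, z2} \<and> center = span {z1, z2} \<and>
    (\<forall>x y. bracket x y = scale (f x y) z1 + scale (g x y) z2)"

lemma in_span_pair: "v \<in> span {a, b} \<longleftrightarrow> (\<exists>s t. v = scale s a + scale t b)"
proof -
  have "v \<in> span {a, b} \<longleftrightarrow> (\<exists>k l. v - scale k a = scale l b)"
    by (auto simp: span_insert span_singleton)
  then show ?thesis by (metis add.commute diff_add_cancel add_diff_cancel_left')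
qed

lemma pair_unique:
  assumes "z1 \<noteq> z2" "independent {z1, z2}"
    and "scale a z1 + scale b z2 = scale c z1 + scale d z2"
  shows "a = c \<and> b = d"
proof -
  have n: "z1 \<notin> span {z2}" "z2 \<noteq> 0"
    using assms(1,2) by (auto simp: independent_insert)
  have e: "scale (a - c) z1 = scale (d - b) z2"
    using assms(3) by (simp add: scale_left_diff_distrib algebra_simps)
  have "a - c = 0"
  proof (rule ccontr)
    assume "a - c \<noteq> 0"
    then have "z1 = scale (1 / (a - c)) (scale (a - c) z1)" by simp
    also have "\<dots> = scale ((d - b) / (a - c)) z2" unfolding e by simp
    finally show False using n(1) by (auto simp: span_singleton)
  qed
  then show ?thesis using e n(2) by simp
qed

lemma coordinates_swap:
  assumes "coordinates z1 z2 f g"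
  shows "coordinates z2 z1 g f"
  using assms by (auto simp: coordinates_def insert_commute add.commute)

lemma coordinates_shear:
  assumes "coordinates z1 z2 f g"
  shows "coordinates (z1 - scale s z2) z2 f (\<lambda>x y. g x y + s * f x y)"
proof -
  have c: "z1 \<noteq> z2" "independent {z1, z2}" "center = span {z1, z2}"
    "\<And>x y. bracket x y = scale (f x y) z1 + scale (g x y) z2"
    using assms by (auto simp: coordinates_def)
  have n: "z1 \<notin> span {z2}" "z2 \<noteq> 0"
    using c(1,2) by (auto simp: independent_insert)
  have n': "z1 - scale s z2 \<notin> span {z2}"
  proof
    assume "z1 - scale s z2 \<in> span {z2}"
    then have "z1 - scale s z2 + scale s z2 \<in> span {z2}"
      by (rule span_add) (auto intro: span_scale span_base)
    then show False using n(1) by simp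
  qed
  have "z2 \<in> span {z2}" by (simp add: span_base)
  then have ne: "z1 - scale s z2 \<noteq> z2" using n' by metis
  have "span {z1 - scale s z2, z2} = span {z1, z2}"
  proof (intro subset_antisym span_minimal subspace_span)
    show "{z1 - scale s z2, z2} \<subseteq> span {z1, z2}"
      by (simp add: span_base span_diff span_scale)
    have "(z1 - scale s z2) + scale s z2 \<in> span {z1 - scale s z2, z2}"
      by (rule span_add[OF span_base span_scale[OF span_base]]) simp_all
    then have "z1 \<in> span {z1 - scale s z2, z2}" by (simp only: diff_add_cancel)
    then show "{z1, z2} \<subseteq> span {z1 - scale s z2, z2}"
      by (simp add: span_base)
  qed
  moreover have "independent {z1 - scale s z2, z2}"
    using n' n(2) by (simp add: independent_insert)
  ultimately show ?thesis using ne c(3,4)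
    by (auto simp: coordinates_def scale_right_diff_distrib scale_left_distrib mult.commute)
qed

lemma coordinates_form_left:
  assumes "coordinates z1 z2 f g"
  shows "alternating_form scale f"
proof
  have c: "z1 \<noteq> z2" "independent {z1, z2}"
    "\<And>x y. bracket x y = scale (f x y) z1 + scale (g x y) z2"
    using assms by (auto simp: coordinates_def)
  note u = pair_unique[OF c(1,2), THEN conjunct1]
  show "f (x + y) z = f x z + f y z" for x y z
    using bracket_add_left[of x y z]
    by (intro u[of _ "g (x + y) z" _ "g x z + g y z"])
      (simp add: c(3) scale_left_distrib algebra_simps)
  show "f x (y + z) = f x y + f x z" for x y z
    using bracket_add_right[of x y z]
    by (intro u[of _ "g x (y + z)" _ "g x y + g x z"])
      (simp add: c(3) scale_left_distrib algebra_simps)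
  show "f (scale k x) y = k * f x y" for k x y
    using bracket_scale_left[of k x y]
    by (intro u[of _ "g (scale k x) y" _ "k * g x y"])
      (simp add: c(3) scale_right_distrib)
  show "f x x = 0" for x
    using bracket_self[of x] by (intro u[of _ "g x x" _ 0]) (simp add: c(3))
qed

lemma coordinates_forms:
  assumes "coordinates z1 z2 f g"
  shows "alternating_form scale f" "alternating_form scale g"
  using assms coordinates_swap coordinates_form_left by blast+

lemma coordinates_exist:
  assumes "dim center = 2" "derived_algebra \<subseteq> center"
  shows "\<exists>z1 z2 f g. coordinates z1 z2 f g"
proof -
  obtain B where B: "B \<subseteq> center" "independent B" "center \<subseteq> span B" "card B = 2"
    using basis_exists[of center] assms(1) by metis
  obtain z1 z2 where z: "B = {z1, z2}" "z1 \<noteq> z2"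
    using B(4) by (auto simp: card_2_iff)
  have s: "center = span {z1, z2}"
    using B z span_minimal[OF B(1) subspace_center] by auto
  have "\<exists>p. bracket x y = scale (fst p) z1 + scale (snd p) z2" for x y
    using bracket_in_derived[of x y] assms(2) unfolding s by (auto simp: in_span_pair)
  then obtain h where "\<And>x y. bracket x y = scale (fst (h x y)) z1 + scale (snd (h x y)) z2"
    by metis
  then have "coordinates z1 z2 (\<lambda>x y. fst (h x y)) (\<lambda>x y. snd (h x y))"
    using z B(2) s by (simp add: coordinates_def)
  then show ?thesis by blast
qed

lemma coordinates_nonzero:
  assumes "coordinates z1 z2 f g" "dim derived_algebra = 2"
  shows "\<exists>x y. f x y \<noteq> 0"
proof (rule ccontr)
  assume "\<not> ?thesis"
  then have "bracket x y \<in> span {z2}" for x y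
    using assms(1) by (auto simp: coordinates_def span_singleton)
  then have "derived_algebra \<subseteq> span {z2}"
    unfolding derived_algebra_def bracket_space_def by (intro span_minimal) auto
  then have "dim derived_algebra \<le> card {z2}" by (rule dim_le_card) simp
  then show False using assms(2) by simp
qed

lemma coordinates_center:
  assumes "coordinates z1 z2 f g" "z \<in> center"
  shows "f z x = 0" "g z x = 0" "f x z = 0" "g x z = 0"
proof -
  interpret F: alternating_form scale f using assms(1) by (rule coordinates_forms)
  interpret G: alternating_form scale g using assms(1) by (rule coordinates_forms)
  have "scale (f z x) z1 + scale (g z x) z2 = scale 0 z1 + scale 0 z2"
    using assms by (metis add_0 center_iff coordinates_def scale_zero_left)
  then show "f z x = 0" "g z x = 0"
    using pair_unique assms(1) unfolding coordinates_def by blast+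
  then show "f x z = 0" "g x z = 0"
    using F.antisym[of x z] G.antisym[of x z] by simp_all
qed

end

section \<open>Normal form of a pair of forms\<close>

locale six_dimensional_lie_algebra = lie_algebra +
  assumes dim_UNIV: "dim UNIV = 6"
begin

lemma independent_spans:
  assumes "S \<subseteq> V" "independent S" "dim V = card S"
  shows "V \<subseteq> span S"
proof -
  obtain B where B: "independent B" "span B = UNIV" "card B = 6"
    using basis_exists[of UNIV] dim_UNIV by (metis top.extremum_uniqueI)
  then have "finite B" using card.infinite by fastforce
  then interpret finite_dimensional_vector_space scale B
    by unfold_locales (use B in auto)
  show ?thesis using assms by (intro card_ge_dim_independent) auto
qed

lemma spans_of_card_six:
  assumes "independent S" "card S = 6"
  shows "span S = UNIV"
  using independent_spans[of S UNIV] assms by (auto simp: dim_UNIV)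

lemma derived_subset_center:
  assumes "center \<subseteq> derived_algebra" "dim center = dim derived_algebra"
  shows "derived_algebra \<subseteq> center"
proof -
  obtain C where C: "C \<subseteq> center" "independent C" "card C = dim center"
    using basis_exists[of center] by metis
  have "derived_algebra \<subseteq> span C"
    using C assms by (intro independent_spans) auto
  also have "\<dots> \<subseteq> center" using C(1) subspace_center by (rule span_minimal)
  finally show ?thesis .
qed

text \<open>Each of the four vectors pairs nontrivially with its partner, while all later entries of the list
  are orthogonal to that partner; so no vector is in the span of those that follow it.\<close>

lemma symplectic_is_basis:
  assumes co: "coordinates z1 z2 f g" and sy: "alternating_form.symplectic f a b c d"
  shows "is_basis [a, b, c, d, z1, z2]"
proof -
  interpret F: alternating_form scale f using co by (rule coordinates_forms)
  have s: "f a b = 1" "f c d = 1" "f a c = 0" "f a d = 0" "f b c = 0" "f b d = 0"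
    using sy by (auto simp: F.symplectic_def)
  have s': "f b a = - 1" "f d c = - 1"
    using s F.antisym[of b a] F.antisym[of d c] by simp_all
  have zz: "z1 \<noteq> z2" "independent {z1, z2}" "z1 \<in> center" "z2 \<in> center"
    using co by (auto simp: coordinates_def span_base)
  note z = coordinates_center(3)[OF co zz(3)] coordinates_center(3)[OF co zz(4)]
  have d: "d \<notin> span {z1, z2}" by (rule F.not_in_span[of c]) (auto simp: s z)
  have c: "c \<notin> span {d, z1, z2}" by (rule F.not_in_span[of d]) (auto simp: s s' z F.self)
  have b: "b \<notin> span {c, d, z1, z2}" by (rule F.not_in_span[of a]) (auto simp: s z)
  have a: "a \<notin> span {b, c, d, z1, z2}" by (rule F.not_in_span[of b]) (auto simp: s s' z F.self)
  have i: "independent {a, b, c, d, z1, z2}"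
    using a b c d zz(2) by (simp add: independent_insertI)
  have dist: "distinct [a, b, c, d, z1, z2]"
    using a b c d zz(1) span_base by fastforce
  then have "card {a, b, c, d, z1, z2} = 6"
    using distinct_card[of "[a, b, c, d, z1, z2]"] by simp
  then show ?thesis using i dist spans_of_card_six[OF i] by (simp add: is_basis_def)
qed

text \<open>Subtracting from any vector outside the span its component along the hyperbolic pair \<open>u\<close>, \<open>v\<close>
  keeps it outside, because \<open>u\<close> and \<open>v\<close> are in the span.\<close>

lemma orthogonal_outside_span:
  assumes co: "coordinates z1 z2 f g" and "finite S" "card S < 6" "u \<in> S" "v \<in> S" "f u v = 1"
  shows "\<exists>p. p \<notin> span S \<and> f u p = 0 \<and> f v p = 0"
proof -
  interpret F: alternating_form scale f using co by (rule coordinates_forms)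
  have "span S \<noteq> UNIV"
    using dim_le_card[of UNIV S] assms(2,3) dim_UNIV by auto
  then obtain c where c: "c \<notin> span S" by blast
  define m where "m = scale (f v c) u - scale (f u c) v"
  have "m \<in> span S"
    unfolding m_def using assms(4,5) by (intro span_diff span_scale span_base)
  then have "c + m \<notin> span S" using c span_diff[of "c + m" S m] by auto
  moreover have "f u (c + m) = 0" "f v (c + m) = 0"
    using assms(6) F.antisym[of v u] by (simp_all add: m_def F.expand)
  ultimately show ?thesis by blast
qed

lemma orthogonal_complement:
  assumes co: "coordinates z1 z2 f g" and "f x y \<noteq> 0"
  shows "\<exists>u v p q. f u v = 1 \<and> f u p = 0 \<and> f u q = 0 \<and> f v p = 0 \<and> f v q = 0 \<and>
    p \<notin> span {z1, z2} \<and> q \<notin> span {p, z1, z2} \<and> span {u, v, p, q, z1, z2} = UNIV"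
proof -
  interpret F: alternating_form scale f using co by (rule coordinates_forms)
  define v where "v = scale (1 / f x y) y"
  have xv: "f x v = 1" using assms(2) by (simp add: v_def F.expand)
  have vx: "f v x = - 1" using xv F.antisym[of v x] by simp
  have zz: "z1 \<noteq> z2" "independent {z1, z2}" "z1 \<in> center" "z2 \<in> center"
    using co by (auto simp: coordinates_def span_base)
  note z = coordinates_center(3)[OF co zz(3)] coordinates_center(3)[OF co zz(4)]
  have v: "v \<notin> span {z1, z2}" by (rule F.not_in_span[of x]) (auto simp: xv z)
  have x: "x \<notin> span {v, z1, z2}" by (rule F.not_in_span[of v]) (auto simp: vx z F.self)
  have cc: "card {x, v, z1, z2} \<le> 4" "card {p, x, v, z1, z2} \<le> 5" for p
    by (simp_all add: card_insert_if)
  obtain p where p: "p \<notin> span {x, v, z1, z2}" "f x p = 0" "f v p = 0"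
    using orthogonal_outside_span[OF co, of "{x, v, z1, z2}" x v] cc(1) xv by auto
  obtain q where q: "q \<notin> span {p, x, v, z1, z2}" "f x q = 0" "f v q = 0"
    using orthogonal_outside_span[OF co, of "{p, x, v, z1, z2}" x v] cc(2)[of p] xv by auto
  have i: "independent {q, p, x, v, z1, z2}"
    using q p x v zz(2) by (simp add: independent_insertI)
  have "distinct [q, p, x, v, z1, z2]"
    using q(1) p(1) x v zz(1) span_base by fastforce
  then have "card {q, p, x, v, z1, z2} = 6"
    using distinct_card[of "[q, p, x, v, z1, z2]"] by simp
  then have "span {q, p, x, v, z1, z2} = UNIV" by (rule spans_of_card_six[OF i])
  moreover have "{q, p, x, v, z1, z2} = {x, v, p, q, z1, z2}" by blast
  moreover have "p \<notin> span {z1, z2}"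
    using p(1) span_mono[of "{z1, z2}" "{x, v, z1, z2}"] by blast
  moreover have "q \<notin> span {p, z1, z2}"
    using q(1) span_mono[of "{p, z1, z2}" "{p, x, v, z1, z2}"] by blast
  ultimately show ?thesis using p q xv by metis
qed

text \<open>Take a basis \<open>u, v, p, q\<close> modulo the centre in which \<open>u, v\<close> is a hyperbolic pair for \<open>f\<close>
  orthogonal to \<open>p, q\<close>. The Pfaffian of \<open>f\<close> is then \<open>f p q\<close>. If it is zero, the Pfaffian of
  \<open>g + s f\<close> is \<open>P + s * g p q\<close>, where \<open>P\<close> is that of \<open>g\<close>. If this vanishes for every \<open>s\<close>, then
  \<open>P\<close> reduces, up to sign, to the determinant of the two-by-two matrix that pairs \<open>u, v\<close> with
  \<open>p, q\<close> under \<open>g\<close>. A vector in its kernel is a combination of \<open>p\<close> and \<open>q\<close> in the radical of both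
  forms, hence central, which contradicts independence.\<close>

lemma symplectic_coordinates_exist:
  assumes co: "coordinates z1 z2 f g" and ne: "f x y \<noteq> 0"
  shows "\<exists>z1 z2 f g a b c d. coordinates z1 z2 f g \<and> alternating_form.symplectic f a b c d"
proof -
  interpret F: alternating_form scale f using co by (rule coordinates_forms)
  interpret G: alternating_form scale g using co by (rule coordinates_forms)
  obtain u v p q where uv: "f u v = 1"
    and o: "f u p = 0" "f u q = 0" "f v p = 0" "f v q = 0"
    and p: "p \<notin> span {z1, z2}" and q: "q \<notin> span {p, z1, z2}"
    and sp: "span {u, v, p, q, z1, z2} = UNIV"
    using orthogonal_complement[OF co ne] by blast
  define P where "P = g u v * g p q - g u p * g v q + g u q * g v p"
  show ?thesis
  proof (cases "f p q = 0")
    case False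
    then have "\<exists>a b c d. F.symplectic a b c d"
      using o uv by (intro F.symplectic_from_Pfaffian[of u v p q]) simp
    then show ?thesis using co by blast
  next
    case fpq: True
    \<comment> \<open>The values \<open>s = 0\<close> and \<open>s = 1\<close> suffice to force both coefficients to vanish.\<close>
    have "\<exists>s. P + s * g p q \<noteq> 0"
    proof (rule ccontr)
      assume "\<nexists>s. P + s * g p q \<noteq> 0"
      then have "P + 0 * g p q = 0" "P + 1 * g p q = 0" by blast+
      then have P: "P = 0" and gpq: "g p q = 0" by simp_all
      obtain s t where st: "s \<noteq> 0 \<or> t \<noteq> 0"
        "s * g u p + t * g u q = 0" "s * g v p + t * g v q = 0"
      proof (cases "g u p = 0 \<and> g u q = 0")
        case True
        show ?thesis
        proof (cases "g v p = 0 \<and> g v q = 0")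
          case True
          with \<open>g u p = 0 \<and> g u q = 0\<close> show ?thesis by (intro that[of 1 0]) simp_all
        next
          case False
          with True show ?thesis by (intro that[of "g v q" "- g v p"]) auto
        qed
      next
        case False
        with P gpq show ?thesis
          by (intro that[of "g u q" "- g u p"]) (auto simp: P_def algebra_simps)
      qed
      define r where "r = scale s p + scale t q"
      have zz: "z1 \<in> center" "z2 \<in> center"
        using co by (auto simp: coordinates_def span_base)
      note z = coordinates_center(3,4)[OF co zz(1)] coordinates_center(3,4)[OF co zz(2)]
      have rf: "f r w = 0" for w
      proof (rule F.vanishes_on_span[of _ "{u, v, p, q, z1, z2}"])
        show "w \<in> span {u, v, p, q, z1, z2}" by (simp add: sp)
        show "f r x = 0" if "x \<in> {u, v, p, q, z1, z2}" for x
          using that o z fpq F.antisym[of p u] F.antisym[of q u] F.antisym[of p v]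
            F.antisym[of q v] F.antisym[of q p]
          by (auto simp: r_def F.expand)
      qed
      have rg: "g r w = 0" for w
      proof (rule G.vanishes_on_span[of _ "{u, v, p, q, z1, z2}"])
        show "w \<in> span {u, v, p, q, z1, z2}" by (simp add: sp)
        have "g u r = 0" "g v r = 0" using st by (simp_all add: r_def G.expand)
        then have "g r u = 0" "g r v = 0" using G.antisym[of r u] G.antisym[of r v] by simp_all
        then show "g r x = 0" if "x \<in> {u, v, p, q, z1, z2}" for x
          using that z gpq G.antisym[of q p] by (auto simp: r_def G.expand)
      qed
      have r: "r \<in> span {z1, z2}"
        using co rf rg by (auto simp: coordinates_def center_iff)
      show False
      proof (cases "t = 0")
        case True
        then have "scale (1 / s) r = p" using st(1) by (simp add: r_def)
        then show False using p span_scale[OF r] by metis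
      next
        case False
        have "r \<in> span {p, z1, z2}" using r span_mono[of "{z1, z2}" "{p, z1, z2}"] by blast
        then have "scale (1 / t) (r - scale s p) \<in> span {p, z1, z2}"
          by (intro span_scale span_diff) (auto intro: span_base)
        then show False using q False by (simp add: r_def)
      qed
    qed
    then obtain s where s: "P + s * g p q \<noteq> 0" by blast
    define h where "h = (\<lambda>x y. g x y + s * f x y)"
    have co': "coordinates z2 (z1 - scale s z2) h f"
      unfolding h_def by (rule coordinates_swap) (rule coordinates_shear[OF co])
    then interpret H: alternating_form scale h by (rule coordinates_forms)
    have "h u v * h p q - h u p * h v q + h u q * h v p = P + s * g p q"
      by (simp add: h_def P_def o fpq uv algebra_simps)
    then have "\<exists>a b c d. H.symplectic a b c d"
      using s by (intro H.symplectic_from_Pfaffian[of u v p q]) simp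
    then show ?thesis using co' by blast
  qed
qed

text \<open>The coefficients of \<open>w\<close> along the symplectic basis are its \<open>f\<close>-products with the partners, up to
  sign, and \<open>h\<close> vanishes on the centre. Separate coordinates for \<open>h\<close> let it be \<open>g\<close> as well as,
  after exchanging \<open>z1\<close> and \<open>z2\<close>, \<open>f\<close> itself.\<close>

lemma symplectic_expansion:
  assumes co: "coordinates z1 z2 f g" and sy: "alternating_form.symplectic f a b c d"
    and co': "coordinates y1 y2 k h"
  shows "h x w = f w b * h x a - f w a * h x b + f w d * h x c - f w c * h x d"
proof -
  interpret F: alternating_form scale f using co by (rule coordinates_forms)
  interpret H: alternating_form scale h using co' by (rule coordinates_forms)
  have s: "f a b = 1" "f c d = 1" "f a c = 0" "f a d = 0" "f b c = 0" "f b d = 0"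
    using sy by (auto simp: F.symplectic_def)
  have s': "f b a = - 1" "f d c = - 1" "f c a = 0" "f d a = 0" "f c b = 0" "f d b = 0"
    using s F.antisym[of b a] F.antisym[of d c] F.antisym[of c a] F.antisym[of d a]
      F.antisym[of c b] F.antisym[of d b] by simp_all
  have zz: "z1 \<in> center" "z2 \<in> center"
    using co by (auto simp: coordinates_def span_base)
  note z = coordinates_center(1)[OF co zz(1)] coordinates_center(1)[OF co zz(2)]
    coordinates_center(4)[OF co' zz(1)] coordinates_center(4)[OF co' zz(2)]
  have "w \<in> span {a, b, c, d, z1, z2}"
    using symplectic_is_basis[OF co sy] by (simp add: is_basis_def)
  then show ?thesis
  proof (induction rule: span_induct_alt)
    case base
    show ?case by (simp add: F.expand H.expand)
  next
    case (step k y w)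
    have "h x y = f y b * h x a - f y a * h x b + f y d * h x c - f y c * h x d"
      using step(1) by (auto simp: s s' z F.self)
    then have "k * h x y = k * (f y b * h x a - f y a * h x b + f y d * h x c - f y c * h x d)"
      by simp
    then show ?case unfolding F.expand H.expand step(2) by (simp add: algebra_simps)
  qed
qed


text \<open>For a symplectic basis of \<open>f\<close>, the sum \<open>g a b + g c d\<close> is the polarisation of the Pfaffian at
  \<open>f\<close> and \<open>g\<close>, and its value at \<open>f\<close> and \<open>f\<close> is \<open>2\<close>.\<close>

lemma trace_free_coordinates_exist:
  assumes co: "coordinates z1 z2 f g" and sy: "alternating_form.symplectic f a b c d"
    and two: "(2::'a) \<noteq> 0"
  shows "\<exists>z1 z2 g. coordinates z1 z2 f g \<and> g a b + g c d = 0"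
proof -
  interpret F: alternating_form scale f using co by (rule coordinates_forms)
  define s where "s = - (g a b + g c d) / 2"
  have "f a b = 1" "f c d = 1" using sy by (simp_all add: F.symplectic_def)
  then have "(g a b + s * f a b) + (g c d + s * f c d) = (g a b + g c d) + 2 * s"
    by (simp add: algebra_simps)
  also have "2 * s = - (g a b + g c d)" using two by (simp add: s_def del: minus_add_distrib)
  finally have "(g a b + s * f a b) + (g c d + s * f c d) = 0" by simp
  then show ?thesis using coordinates_shear[OF co, of s] by blast
qed

text \<open>If \<open>g u w\<close> vanished whenever \<open>f u w\<close> does, then \<open>g\<close> would be a multiple of \<open>f\<close>, and the trace
  condition would make that multiple zero.\<close>

lemma orthogonal_pair_exists:
  assumes co: "coordinates z1 z2 f g" and sy: "alternating_form.symplectic f a b c d"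
    and tr: "g a b + g c d = 0" and two: "(2::'a) \<noteq> 0" and ne: "g x y \<noteq> 0"
  shows "\<exists>u w. f u w = 0 \<and> g u w = 1"
proof -
  interpret F: alternating_form scale f using co by (rule coordinates_forms)
  interpret G: alternating_form scale g using co by (rule coordinates_forms)
  have s: "f a b = 1" "f c d = 1" "f a c = 0" "f a d = 0" "f b c = 0" "f b d = 0"
    using sy by (auto simp: F.symplectic_def)
  have "\<exists>u w. f u w = 0 \<and> g u w \<noteq> 0"
  proof (rule ccontr)
    assume "\<not> ?thesis"
    then have h: "f u w = 0 \<Longrightarrow> g u w = 0" for u w by blast
    have g0: "g a c = 0" "g a d = 0" "g b c = 0" "g b d = 0" using h s by blast+
    \<comment> \<open>This pair is orthogonal for \<open>f\<close> and compares the two diagonal values of \<open>g\<close>.\<close>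
    have "f (a + c) (b - d) = 0"
      using s F.antisym[of c b] by (simp add: F.expand)
    then have "g (a + c) (b - d) = 0" by (rule h)
    then have "g a b = g c d"
      using g0 G.antisym[of c b] by (simp add: G.expand)
    then have "2 * g a b = 0" using tr by simp
    then have "g a b = 0" "g c d = 0" using two \<open>g a b = g c d\<close> by simp_all
    note g0 = g0 this
    have g0': "g b a = 0" "g d c = 0" "g c a = 0" "g d a = 0" "g c b = 0" "g d b = 0"
      using g0 G.antisym[of b a] G.antisym[of d c] G.antisym[of c a] G.antisym[of d a]
        G.antisym[of c b] G.antisym[of d b] by simp_all
    note e = symplectic_expansion[OF co sy co]
    have "g a w = 0" "g b w = 0" "g c w = 0" "g d w = 0" for w
      using e[of _ w] by (simp_all add: g0 g0' G.self)
    then have "g w a = 0" "g w b = 0" "g w c = 0" "g w d = 0" for w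
      using G.antisym[of w] by simp_all
    then have "g x y = 0" using e[of x y] by simp
    then show False using ne by simp
  qed
  then obtain u w where "f u w = 0" "g u w \<noteq> 0" by blast
  then have "f u (scale (1 / g u w) w) = 0 \<and> g u (scale (1 / g u w) w) = 1"
    by (simp add: F.expand G.expand)
  then show ?thesis by blast
qed

text \<open>\<open>A\<close> is \<open>g\<close> followed by the inverse of the nondegenerate \<open>f\<close>, and the second equation
  says \<open>A\<^sup>2 = \<beta>\<close> modulo the centre. It is the Cayley--Hamilton identity for the Pfaffian of \<open>t f - g\<close>,
  which is \<open>t\<^sup>2 - \<beta>\<close> by the trace condition; \<open>- \<beta>\<close> is the Pfaffian of \<open>g\<close>.\<close>

lemma adjoint_operator_exists:
  assumes co: "coordinates z1 z2 f g" and sy: "alternating_form.symplectic f a b c d"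
    and tr: "g a b + g c d = 0"
  shows "\<exists>A \<beta>. \<forall>u w. f (A u) w = g u w \<and> g (A u) w = \<beta> * f u w"
proof -
  interpret F: alternating_form scale f using co by (rule coordinates_forms)
  interpret G: alternating_form scale g using co by (rule coordinates_forms)
  note ef = symplectic_expansion[OF co sy coordinates_swap[OF co]]
  note eg = symplectic_expansion[OF co sy co]
  define A where "A u = scale (g u b) a - scale (g u a) b + scale (g u d) c - scale (g u c) d" for u
  define \<beta> where "\<beta> = g a b * g a b + g a c * g b d - g a d * g b c"
  have "f (A u) w = g u w" for u w
    using eg[of u w] F.antisym[of a w] F.antisym[of b w] F.antisym[of c w] F.antisym[of d w]
    by (simp add: A_def F.expand algebra_simps)
  moreover have "g (A u) w = \<beta> * f u w" for u w
  proof -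
    have t: "g c d = - g a b" using tr by (simp add: eq_neg_iff_add_eq_0 add.commute)
    have anti: "g b a = - g a b" "g d c = g a b" "g c a = - g a c" "g d a = - g a d"
      "g c b = - g b c" "g d b = - g b d"
      using t G.antisym[of b a] G.antisym[of d c] G.antisym[of c a] G.antisym[of d a]
        G.antisym[of c b] G.antisym[of d b] by simp_all
    have gw: "g v w = f w b * g v a - f w a * g v b + f w d * g v c - f w c * g v d" for v
      by (rule eg)
    have gu: "g u v = - (f u b * g v a - f u a * g v b + f u d * g v c - f u c * g v d)" for v
      using eg[of v u] G.antisym[of u v] by simp
    have "g (A u) w = g u b * g a w - g u a * g b w + g u d * g c w - g u c * g d w"
      by (simp add: A_def G.expand)
    also have "\<dots> = \<beta> * (f w b * f u a - f w a * f u b + f w d * f u c - f w c * f u d)"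
      unfolding gw gu anti t G.self \<beta>_def by (simp add: algebra_simps)
    also have "\<dots> = \<beta> * f u w" using ef[of u w] by simp
    finally show ?thesis .
  qed
  ultimately show ?thesis by blast
qed

text \<open>\<open>A\<close> is self-adjoint for both forms, so every product of two vectors among \<open>u, w, A u, A w\<close>
  reduces to a multiple of \<open>f\<close> or \<open>g\<close> on \<open>u, w\<close>.\<close>

lemma normal_form_of_adjoint_operator:
  assumes "alternating_form scale f" "alternating_form scale g"
    and A: "\<And>u w. f (A u) w = g u w" "\<And>u w. g (A u) w = \<beta> * f u w"
    and u: "f u w = 0" "g u w = 1"
  defines "x \<equiv> - A w" and "y \<equiv> - A u"
  shows "alternating_form.symplectic f x u w y"
    and "g u w = 1 \<and> g x y = - \<beta> \<and> g x u = 0 \<and> g x w = 0 \<and> g u y = 0 \<and> g w y = 0"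
proof -
  interpret F: alternating_form scale f by fact
  interpret G: alternating_form scale g by fact
  have r: "f v (A v') = g v v'" "g v (A v') = \<beta> * f v v'" for v v'
    using F.antisym[of v "A v'"] G.antisym[of v "A v'"] F.antisym[of v v'] G.antisym[of v v']
    by (simp_all add: A)
  have "f w u = 0" "g w u = - 1" using u F.antisym[of w u] G.antisym[of w u] by simp_all
  with u show "F.symplectic x u w y"
    "g u w = 1 \<and> g x y = - \<beta> \<and> g x u = 0 \<and> g x w = 0 \<and> g u y = 0 \<and> g w y = 0"
    by (simp_all add: F.symplectic_def x_def y_def F.expand G.expand A r)
qed

end

section \<open>The classification\<close>

theorem theorem4p7:
  fixes scale :: "'f::field \<Rightarrow> 'v::ab_group_add \<Rightarrow> 'v"
    and bracket :: "'v \<Rightarrow> 'v \<Rightarrow> 'v"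
  assumes "CHAR('f) \<noteq> 2"
    and "lie_algebra scale bracket"
    and "vector_space.dim scale (UNIV :: 'v set) = 6"
    and "lie_algebra.pure scale bracket"
    and "lie_algebra.nilpotent scale bracket"
    and "lie_algebra.breadth scale bracket = 2"
    and "vector_space.dim scale (lie_algebra.center bracket) = 2"
    and "vector_space.dim scale (lie_algebra.derived_algebra scale bracket) = 2"
  shows "\<exists>x1 x2 x3 x4 z1 z2.
    lie_algebra.is_basis scale [x1, x2, x3, x4, z1, z2] \<and>
    (\<forall>v \<in> {x1, x2, x3, x4, z1, z2}. bracket z1 v = 0 \<and> bracket z2 v = 0) \<and>
    ((bracket x1 x2 = z1 \<and> bracket x3 x4 = z2 \<and>
      bracket x1 x3 = 0 \<and> bracket x1 x4 = 0 \<and> bracket x2 x3 = 0 \<and> bracket x2 x4 = 0)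
     \<or>
     (\<exists>\<alpha>. bracket x1 x2 = z1 \<and> bracket x2 x3 = z2 \<and> bracket x3 x4 = z1 \<and>
      bracket x1 x4 = scale \<alpha> z2 \<and>
      bracket x1 x3 = 0 \<and> bracket x2 x4 = 0))"
proof -
  interpret six_dimensional_lie_algebra scale bracket
    using assms(2,3) by (simp add: six_dimensional_lie_algebra_def six_dimensional_lie_algebra_axioms_def)
  have two: "(2::'f) \<noteq> 0"
  proof
    assume "(2::'f) = 0"
    then have "of_nat 2 = (0::'f)" by simp
    then have "CHAR('f) dvd 2" by (simp only: of_nat_eq_0_iff_char_dvd)
    then have "CHAR('f) = 1 \<or> CHAR('f) = 2" using two_is_prime_nat by (auto simp: prime_nat_iff)
    then show False using assms(1) by simp
  qed
  have "derived_algebra \<subseteq> center"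
    using pure_center_subset_derived[OF assms(4)] assms(7,8) by (intro derived_subset_center) simp_all
  then obtain z1 z2 f g where "coordinates z1 z2 f g"
    using coordinates_exist assms(7) by blast
  moreover from this obtain x y where "f x y \<noteq> 0"
    using coordinates_nonzero assms(8) by blast
  ultimately obtain z1 z2 f g a b c d where co: "coordinates z1 z2 f g"
    and sy: "alternating_form.symplectic f a b c d"
    using symplectic_coordinates_exist by metis
  obtain z1 z2 g where co: "coordinates z1 z2 f g" and tr: "g a b + g c d = 0"
    using trace_free_coordinates_exist[OF co sy two] by metis
  note forms = coordinates_forms[OF co]
  obtain x y where "g x y \<noteq> 0"
    using coordinates_nonzero[OF coordinates_swap[OF co] assms(8)] by blast
  then obtain u w where u: "f u w = 0" "g u w = 1"
    using orthogonal_pair_exists[OF co sy tr two] by blast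
  obtain A \<beta> where A: "\<And>u w. f (A u) w = g u w" "\<And>u w. g (A u) w = \<beta> * f u w"
    using adjoint_operator_exists[OF co sy tr] by blast
  have sy': "alternating_form.symplectic f (- A w) u w (- A u)"
    by (rule normal_form_of_adjoint_operator[OF forms A u])
  have g: "g u w = 1 \<and> g (- A w) (- A u) = - \<beta> \<and> g (- A w) u = 0 \<and> g (- A w) w = 0 \<and>
      g u (- A u) = 0 \<and> g w (- A u) = 0"
    by (rule normal_form_of_adjoint_operator[OF forms A u])
  have f: "f (- A w) u = 1 \<and> f w (- A u) = 1 \<and> f (- A w) w = 0 \<and> f (- A w) (- A u) = 0 \<and>
      f u w = 0 \<and> f u (- A u) = 0"
    using sy' unfolding alternating_form.symplectic_def[OF forms(1)] .
  have br: "bracket x y = scale (f x y) z1 + scale (g x y) z2" for x y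
    using co by (simp add: coordinates_def)
  have "z1 \<in> center" "z2 \<in> center"
    using co by (auto simp: coordinates_def span_base)
  then have z: "\<forall>v. bracket z1 v = 0 \<and> bracket z2 v = 0" by (simp add: center_iff)
  have ib: "is_basis [- A w, u, w, - A u, z1, z2]"
    by (rule symplectic_is_basis[OF co sy'])
  have al: "bracket (- A w) u = z1 \<and> bracket u w = z2 \<and> bracket w (- A u) = z1 \<and>
      bracket (- A w) (- A u) = scale (- \<beta>) z2 \<and>
      bracket (- A w) w = 0 \<and> bracket u (- A u) = 0"
    by (simp only: br f g) simp
  show ?thesis
    using ib z al by blast
qed

end
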